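(* Let $\beta>1$ be an algebraic integer of degree $d$ and let $C\in\mathbb{Z}^{d\times d}$ be the companion matrix of $\beta$. If $q\in\mathbb{N}$, $q>2$, has the Midy property in base $\beta$, then there exists a positive integer $N$ such that $C^N\equiv -I \pmod q$ (entrywise congruence, $I$ the $d\times d$ identity matrix).
   Context: For real $\beta>1$, the $\beta$-transformation is $T:[0,1]\to[0,1)$, $T(x)=\beta x-\lfloor \beta x\rfloor$. The $\beta$-expansion of $x\in(0,1)$ is $(x)_\beta=0.x_1x_2x_3\cdots$ with digits $x_i=\lfloor \beta T^{i-1}(x)\rfloor$, so that $x=\sum_{i\ge1}x_i\beta^{-i}$. It is purely periodic if the digit sequence $x_1x_2x_3\cdots$ equals $(c_1\cdots c_m)^\omega$ (infinite repetition of the block $c_1\cdots c_m$) for some $m\ge 1$. Midy property: $q\in\mathbb{N}$ has the Midy property in base $\beta$ if there exists a positive integer $p<q$ coprime with $q$ such that (a) the $\beta$-expansion of $p/q$ is purely periodic, $(p/q)_\beta=0.(c_1c_2\cdots c_{2n})^\omega$, where $2n$ (an even number, $n\ge1$) is the length of the shortest period; and (b) $x+y=\beta^n-1$, where $x=\sum_{i=1}^n c_i\beta^{n-i}$ and $y=\sum_{i=1}^n c_{n+i}\beta^{n-i}$. Companion matrix: if $f(X)=X^d-c_{d-1}X^{d-1}-\cdots-c_1X-c_0\in\mathbb{Z}[X]$ is the minimal polynomial of $\beta$, then $C$ is the $d\times d$ matrix with ones on the subdiagonal, last column $(c_0,c_1,\dots,c_{d-1})^T$, and zeros elsewhere (for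 $d=1$, $C=(c_0)$). *)

theory Defs
  imports
    Complex_Main
    "HOL-Computational_Algebra.Polynomial"
    "HOL-Number_Theory.Cong"
    "Jordan_Normal_Form.Matrix"
begin

definition beta_T :: "real \<Rightarrow> real \<Rightarrow> real" where
  "beta_T \<beta> x = \<beta> * x - of_int \<lfloor>\<beta> * x\<rfloor>"

(* Digits are numbered from 1; the value at index 0 is irrelevant. *)
definition beta_digit :: "real \<Rightarrow> real \<Rightarrow> nat \<Rightarrow> int" where
  "beta_digit \<beta> x i = \<lfloor>\<beta> * (beta_T \<beta> ^^ (i - 1)) x\<rfloor>"

(* The digit sequence of x is the infinite repetition of the block c 1, ..., c m. *)
definition purely_periodic_block :: "real \<Rightarrow> real \<Rightarrow> nat \<Rightarrow> (nat \<Rightarrow> int) \<Rightarrow> bool" where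
  "purely_periodic_block \<beta> x m c \<longleftrightarrow>
     m \<ge> 1 \<and> (\<forall>i\<ge>1. beta_digit \<beta> x i = c ((i - 1) mod m + 1))"

definition shortest_period_block :: "real \<Rightarrow> real \<Rightarrow> nat \<Rightarrow> (nat \<Rightarrow> int) \<Rightarrow> bool" where
  "shortest_period_block \<beta> x m c \<longleftrightarrow>
     purely_periodic_block \<beta> x m c \<and>
     (\<forall>m' c'. purely_periodic_block \<beta> x m' c' \<longrightarrow> m \<le> m')"

definition midy_property :: "real \<Rightarrow> nat \<Rightarrow> bool" where
  "midy_property \<beta> q \<longleftrightarrow>
     (\<exists>(p::nat) (n::nat) (c::nat \<Rightarrow> int).
        0 < p \<and> p < q \<and> coprime p q \<and> n \<ge> 1 \<and>
        shortest_period_block \<beta> (real p / real q) (2 * n) c \<and>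
        (\<Sum>i=1..n. of_int (c i) * \<beta> ^ (n - i)) +
        (\<Sum>i=1..n. of_int (c (n + i)) * \<beta> ^ (n - i)) = \<beta> ^ n - 1)"

definition is_min_poly :: "rat poly \<Rightarrow> real \<Rightarrow> bool" where
  "is_min_poly g x \<longleftrightarrow>
     lead_coeff g = 1 \<and> poly (map_poly of_rat g) x = 0 \<and>
     (\<forall>h. h \<noteq> 0 \<and> poly (map_poly of_rat h) x = 0 \<longrightarrow> degree g \<le> degree h)"

lemma clear_denominators:
  fixes g :: "rat poly"
  shows "\<exists>a G. a > 0 \<and> Polynomial.smult (of_int a) g = map_poly of_int (G :: int poly)"
proof (induction g)
  case 0
  show ?case by (rule exI[of _ 1], rule exI[of _ 0]) simp
next
  case (pCons c g)
  then obtain a G where aG: "a > 0" "Polynomial.smult (of_int a) g = map_poly of_int (G :: int poly)" by blast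
  obtain n b where nb: "quotient_of c = (n, b)" by force
  have b: "b > 0" "c = of_int n / of_int b"
    using nb quotient_of_denom_pos quotient_of_div by blast+
  have "Polynomial.smult (of_int (b * a)) g = Polynomial.smult (of_int b) (Polynomial.smult (of_int a) g)" by simp
  also have "\<dots> = map_poly of_int (Polynomial.smult b G)"
    unfolding aG(2) by (intro poly_eqI) (simp add: coeff_map_poly)
  finally have "Polynomial.smult (of_int (b * a)) (pCons c g) = map_poly of_int (pCons (n * a) (Polynomial.smult b G))"
    using b by (simp add: map_poly_pCons field_simps)
  thus ?case using aG(1) b(1) by (metis mult_pos_pos)
qed

lemma is_min_poly_exists:
  assumes "algebraic_int x"
  shows "\<exists>f :: int poly. is_min_poly (map_poly of_int f) x"
proof -
  define R where "R h = poly (map_poly of_rat h) x" for h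
  have R_add: "R (g + h) = R g + R h" for g h
    unfolding R_def poly_add[symmetric]
    by (rule arg_cong[where f = "\<lambda>p. poly p x"], rule poly_eqI) (simp add: coeff_map_poly of_rat_add)
  have R_mult: "R (g * h) = R g * R h" for g h
    unfolding R_def poly_mult[symmetric]
    by (rule arg_cong[where f = "\<lambda>p. poly p x"], rule poly_eqI)
       (simp add: coeff_map_poly coeff_mult of_rat_sum of_rat_mult)
  obtain P :: "int poly" where P: "poly (map_poly of_int P) x = 0" "lead_coeff P = 1"
    using assms by (auto simp: algebraic_int_altdef_ipoly)
  define P' where "P' = (map_poly of_int P :: rat poly)"
  have P': "R P' = 0" "P' \<noteq> 0"
  proof -
    have "map_poly of_rat P' = (map_poly of_int P :: real poly)"
      unfolding P'_def by (rule poly_eqI) (simp add: coeff_map_poly)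
    thus "R P' = 0" using P(1) by (simp add: R_def)
    have "coeff P' (degree P) = 1" using P(2) by (simp add: P'_def coeff_map_poly)
    thus "P' \<noteq> 0" by auto
  qed
  obtain g where g: "g \<noteq> 0" "R g = 0" "\<And>h. h \<noteq> 0 \<Longrightarrow> R h = 0 \<Longrightarrow> degree g \<le> degree h"
    using ex_has_least_nat[of "\<lambda>h. h \<noteq> 0 \<and> R h = 0" P' degree] P' by blast
  have "R (P' mod g) = 0"
    using R_add[of "P' div g * g" "P' mod g"] R_mult[of "P' div g" g] P'(1) g(2) by simp
  hence "P' mod g = 0"
    using g(1) g(3)[of "P' mod g"] degree_mod_less[of g P'] by force
  then obtain h where h: "P' = g * h" by (metis mod_0_imp_dvd dvdE)
  obtain a G where G: "a > 0" "Polynomial.smult (of_int a) g = map_poly of_int (G :: int poly)"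
    using clear_denominators by blast
  obtain b H where H: "b > 0" "Polynomial.smult (of_int b) h = map_poly of_int (H :: int poly)"
    using clear_denominators by blast
  have "map_poly rat_of_int (Polynomial.smult (a * b) P) = Polynomial.smult (of_int (a * b)) P'"
    unfolding P'_def by (rule poly_eqI) (simp add: coeff_map_poly)
  also have "\<dots> = map_poly of_int G * map_poly of_int H"
    unfolding h G(2)[symmetric] H(2)[symmetric] by (simp add: mult.commute)
  also have "\<dots> = map_poly of_int (G * H)"
    by (rule poly_eqI) (simp add: coeff_map_poly coeff_mult)
  finally have eq: "Polynomial.smult (a * b) P = G * H"
    by (simp add: poly_eq_iff coeff_map_poly flip: of_int_mult)
  have cP: "content P = 1"
    using content_dvd_coeff[of P "degree P"] P(2)
    by (metis is_unit_normalize normalize_content)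
  have "G * H = Polynomial.smult (content G) (primitive_part G) * Polynomial.smult (content H) (primitive_part H)"
    by (simp only: content_times_primitive_part)
  also have "\<dots> = Polynomial.smult (content G * content H) (primitive_part G * primitive_part H)"
    by (simp only: mult_smult_left mult_smult_right smult_smult mult.commute)
  finally have "G * H = Polynomial.smult (content G * content H) (primitive_part G * primitive_part H)" .
  moreover have "content G * content H = a * b"
  proof -
    have "content G * content H = content (Polynomial.smult (a * b) P)" by (simp add: eq content_mult)
    also have "\<dots> = a * b" using cP G(1) H(1) by simp
    finally show ?thesis .
  qed
  ultimately have PP: "P = primitive_part G * primitive_part H"
    using eq G(1) H(1) by (simp add: poly_eq_iff)
  define u where "u = lead_coeff (primitive_part G)"
  have uu: "u * u = 1"
  proof -
    have "u * lead_coeff (primitive_part H) = 1"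
      using P(2) unfolding PP u_def by (simp add: lead_coeff_mult)
    hence "u = 1 \<or> u = - 1" by (auto simp: zmult_eq_1_iff)
    thus ?thesis by auto
  qed
  define f where "f = Polynomial.smult u (primitive_part G)"
  define f' where "f' = (map_poly of_int f :: rat poly)"
  have lf: "lead_coeff f = 1" using uu unfolding f_def lead_coeff_smult u_def .
  have G0: "G \<noteq> 0"
  proof
    assume "G = 0"
    with G(2) have "Polynomial.smult (of_int a) g = 0" by simp
    thus False using G(1) g(1) by simp
  qed
  define k where "k = (of_int a / of_int (content G * u) :: rat)"
  have u0: "u \<noteq> 0" using uu by auto
  have f'k: "f' = Polynomial.smult k g"
  proof -
    have "Polynomial.smult (of_int (content G * u)) f' = map_poly of_int (Polynomial.smult (content G * u) f)"
      unfolding f'_def by (rule poly_eqI) (simp add: coeff_map_poly)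
    also have "Polynomial.smult (content G * u) f = Polynomial.smult (content G * (u * u)) (primitive_part G)"
      by (simp add: f_def mult_ac)
    also have "\<dots> = G" by (simp add: uu)
    also have "map_poly rat_of_int G = Polynomial.smult (of_int a) g" using G(2) by simp
    finally have "Polynomial.smult (inverse (of_int (content G * u))) (Polynomial.smult (of_int (content G * u)) f')
        = Polynomial.smult (inverse (of_int (content G * u))) (Polynomial.smult (of_int a) g)" by (rule arg_cong)
    thus ?thesis using u0 G0 by (simp add: k_def field_simps)
  qed
  have k0: "k \<noteq> 0" using G(1) G0 u0 by (simp add: k_def)
  have "R f' = 0"
    using R_mult[of "[:k:]" g] g(2) f'k by simp
  moreover have "degree f' = degree g" unfolding f'k using k0 by simp
  moreover have "lead_coeff f' = 1"
    using lf by (simp add: f'_def coeff_map_poly degree_map_poly)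
  ultimately have "is_min_poly f' x"
    using g(3) by (auto simp: is_min_poly_def R_def)
  thus ?thesis unfolding f'_def by blast
qed

lemma is_min_poly_unique:
  assumes "is_min_poly g x" "is_min_poly h x"
  shows "g = h"
proof (rule ccontr)
  assume ne: "g \<noteq> h"
  have deg: "degree g = degree h"
  proof (rule antisym)
    show "degree g \<le> degree h" "degree h \<le> degree g"
      using assms by (auto simp: is_min_poly_def) (metis leading_coeff_0_iff zero_neq_one)+
  qed
  have "map_poly of_rat (g - h) = map_poly of_rat g - (map_poly of_rat h :: real poly)"
    by (rule poly_eqI) (simp add: coeff_map_poly of_rat_diff)
  hence "poly (map_poly of_rat (g - h)) x = 0"
    using assms by (simp add: is_min_poly_def)
  hence le: "degree g \<le> degree (g - h)"
    using assms(1) ne by (simp add: is_min_poly_def)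
  have "coeff (g - h) (degree g) = 0" using assms deg by (simp add: is_min_poly_def)
  moreover have "degree (g - h) \<le> degree g" using degree_diff_le_max[of g h] deg by simp
  ultimately have "lead_coeff (g - h) = 0" using le by simp
  hence "g - h = 0" by (simp only: leading_coeff_0_iff)
  thus False using ne by simp
qed

(* For f = X^d - c_{d-1} X^{d-1} - ... - c_0 one has c_i = - coeff f i;
   rows and columns are numbered from 0, so the last column is d - 1. *)
definition companion_mat :: "int poly \<Rightarrow> int mat" where
  "companion_mat f = (let d = degree f in
     mat d d (\<lambda>(i, j). if j = d - 1 then - coeff f i else if i = j + 1 then 1 else 0))"

end

theory Submission
  imports Defs
begin

text \<open>Write \<open>r = p/q\<close>. Periodicity of the digits gives \<open>(\<beta>^(2n) - 1) r = x \<beta>^n + y\<close>, and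
  \<open>x + y = \<beta>^n - 1\<close> turns the right-hand side into \<open>(x + 1) (\<beta>^n - 1)\<close>; hence
  \<open>p (\<beta>^n + 1) = q (x + 1)\<close>. As \<open>p\<close> and \<open>q\<close> are coprime, \<open>\<beta>^n + 1\<close> is \<open>q\<close> times an element
  of \<open>\<int>[\<beta>]\<close>. The companion matrix represents multiplication by \<open>\<beta>\<close> in the basis
  \<open>1, \<beta>, \<dots>, \<beta>^(d-1)\<close> of \<open>\<int>[\<beta>]\<close>, so all entries of \<open>C^n + I\<close> are divisible by \<open>q\<close>.\<close>

section \<open>Purely periodic expansions\<close>

text \<open>The index \<open>Suc k\<close> is there because \<open>z\<close> is an arbitrary real:
  the orbit is sure to lie in [0,1) only after at least one application of
  \<open>beta_T\<close>.\<close>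

lemma beta_T_funpow_bounds:
  "0 \<le> (beta_T \<beta> ^^ Suc k) z" "(beta_T \<beta> ^^ Suc k) z < 1"
  by (simp_all add: beta_T_def[of \<beta> "(beta_T \<beta> ^^ k) z"]) linarith+

text \<open>Horner's scheme: each step multiplies the remainder by \<beta> and splits off the next
  digit.\<close>

lemma beta_expansion_truncation:
  "\<beta> ^ k * z - (beta_T \<beta> ^^ k) z = (\<Sum>i=1..k. of_int (beta_digit \<beta> z i) * \<beta> ^ (k - i))"
proof (induction k)
  case 0
  then show ?case by simp
next
  case (Suc k)
  have "(\<Sum>i=1..k. of_int (beta_digit \<beta> z i) * \<beta> ^ (Suc k - i))
      = \<beta> * (\<Sum>i=1..k. of_int (beta_digit \<beta> z i) * \<beta> ^ (k - i))"
    unfolding sum_distrib_left by (rule sum.cong) (auto simp: Suc_diff_le)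
  also have "\<dots> = \<beta> * (\<beta> ^ k * z - (beta_T \<beta> ^^ k) z)"
    by (simp only: Suc.IH)
  finally have IH: "(\<Sum>i=1..k. of_int (beta_digit \<beta> z i) * \<beta> ^ (Suc k - i))
      = \<beta> * (\<beta> ^ k * z - (beta_T \<beta> ^^ k) z)" .
  have "(beta_T \<beta> ^^ Suc k) z = \<beta> * (beta_T \<beta> ^^ k) z - of_int (beta_digit \<beta> z (Suc k))"
    by (simp add: beta_digit_def beta_T_def[of \<beta> "(beta_T \<beta> ^^ k) z"])
  with IH show ?case by (simp add: right_diff_distrib)
qed

lemma beta_digit_funpow:
  assumes "i \<ge> 1"
  shows "beta_digit \<beta> ((beta_T \<beta> ^^ m) z) i = beta_digit \<beta> z (i + m)"
proof -
  have "i + m - 1 = (i - 1) + m" using assms by simp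
  then show ?thesis by (simp add: beta_digit_def funpow_add)
qed

text \<open>Equal digits make \<beta>^k (z - w) a difference of two points of [0,1) for every k > 0,
  hence bounded by 1, whereas \<beta>^k grows without bound.\<close>

lemma beta_digits_inject:
  assumes "\<beta> > 1" and eq: "\<And>i. i \<ge> 1 \<Longrightarrow> beta_digit \<beta> z i = beta_digit \<beta> w i"
  shows "z = w"
proof (rule ccontr)
  assume "z \<noteq> w"
  then obtain k where "1 / \<bar>z - w\<bar> < \<beta> ^ k"
    using real_arch_pow[OF assms(1)] by blast
  \<comment> \<open>The exponent is raised by one so that \<open>beta_T_funpow_bounds\<close>
    applies.\<close>
  also have "\<dots> \<le> \<beta> ^ Suc k" using assms(1) by simp
  finally have big: "1 < \<beta> ^ Suc k * \<bar>z - w\<bar>"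
    using \<open>z \<noteq> w\<close> by (simp add: field_simps)
  have "\<beta> ^ Suc k * z - (beta_T \<beta> ^^ Suc k) z = \<beta> ^ Suc k * w - (beta_T \<beta> ^^ Suc k) w"
    unfolding beta_expansion_truncation by (rule sum.cong) (auto simp: eq)
  then have "\<beta> ^ Suc k * (z - w) = (beta_T \<beta> ^^ Suc k) z - (beta_T \<beta> ^^ Suc k) w"
    unfolding right_diff_distrib by linarith
  then have "\<bar>\<beta> ^ Suc k * (z - w)\<bar> < 1"
    using beta_T_funpow_bounds[where \<beta> = \<beta> and k = k and z = z]
      beta_T_funpow_bounds[where \<beta> = \<beta> and k = k and z = w] by linarith
  with big assms(1) show False by (simp add: abs_mult)
qed

text \<open>Shifting by m leaves the digits unchanged, so by injectivity \<open>z\<close> is a fixed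
  point of the m-th iterate, and truncation after m digits becomes a closed equation for
  \<open>z\<close>.\<close>

lemma purely_periodic_block_value:
  assumes "\<beta> > 1" "purely_periodic_block \<beta> z m c"
  shows "(\<beta> ^ m - 1) * z = (\<Sum>i=1..m. of_int (c i) * \<beta> ^ (m - i))"
proof -
  have m: "m \<ge> 1" and c: "\<And>i. i \<ge> 1 \<Longrightarrow> beta_digit \<beta> z i = c ((i - 1) mod m + 1)"
    using assms(2) by (auto simp: purely_periodic_block_def)
  have "(beta_T \<beta> ^^ m) z = z"
  proof (rule beta_digits_inject[OF assms(1)])
    fix i :: nat assume i: "i \<ge> 1"
    then have "i + m - 1 = (i - 1) + m" by simp
    then have "(i + m - 1) mod m = (i - 1) mod m" by simp
    then show "beta_digit \<beta> ((beta_T \<beta> ^^ m) z) i = beta_digit \<beta> z i"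
      using i by (simp only: beta_digit_funpow c trans_le_add1)
  qed
  then have "(\<beta> ^ m - 1) * z = (\<Sum>i=1..m. of_int (beta_digit \<beta> z i) * \<beta> ^ (m - i))"
    using beta_expansion_truncation[where k = m and \<beta> = \<beta> and z = z] by (simp add: left_diff_distrib)
  \<comment> \<open>For 1 \<le> i \<le> m the index (i - 1) mod m + 1 is i itself.\<close>
  also have "\<dots> = (\<Sum>i=1..m. of_int (c i) * \<beta> ^ (m - i))"
    by (rule sum.cong) (auto simp: c)
  finally show ?thesis .
qed

lemma midy_property_quotient:
  assumes "\<beta> > 1" "midy_property \<beta> q"
  obtains p n :: nat and c :: "nat \<Rightarrow> int"
  where "coprime p q" "n \<ge> 1"
    "real p * (\<beta> ^ n + 1) = real q * ((\<Sum>i=1..n. of_int (c i) * \<beta> ^ (n - i)) + 1)"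
proof -
  obtain p n :: nat and c :: "nat \<Rightarrow> int" where
    pq: "0 < p" "p < q" "coprime p q" and n: "n \<ge> 1"
    and block: "purely_periodic_block \<beta> (real p / real q) (2 * n) c"
    and sum: "(\<Sum>i=1..n. of_int (c i) * \<beta> ^ (n - i)) +
        (\<Sum>i=1..n. of_int (c (n + i)) * \<beta> ^ (n - i)) = \<beta> ^ n - 1"
    using assms(2) unfolding midy_property_def shortest_period_block_def by blast
  define x y where "x = (\<Sum>i=1..n. of_int (c i) * \<beta> ^ (n - i))"
    and "y = (\<Sum>i=1..n. of_int (c (n + i)) * \<beta> ^ (n - i))"
  have "(\<Sum>i=1..2*n. of_int (c i) * \<beta> ^ (2 * n - i))
      = (\<Sum>i=1..n. of_int (c i) * \<beta> ^ (2 * n - i)) + (\<Sum>i=n+1..n+n. of_int (c i) * \<beta> ^ (2 * n - i))"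
    unfolding mult_2 by (rule sum.ub_add_nat) simp
  also have "(\<Sum>i=1..n. of_int (c i) * \<beta> ^ (2 * n - i)) = x * \<beta> ^ n"
    unfolding x_def sum_distrib_right
    by (rule sum.cong) (auto simp: power_add[symmetric] mult.assoc mult_2)
  also have "(\<Sum>i=n+1..n+n. of_int (c i) * \<beta> ^ (2 * n - i)) = y"
    unfolding y_def by (rule sum.reindex_bij_witness[where i = "\<lambda>i. n + i" and j = "\<lambda>i. i - n"]) (auto simp: mult_2)
  finally have "(\<beta> ^ (2 * n) - 1) * (real p / real q) = x * \<beta> ^ n + y"
    using purely_periodic_block_value[OF assms(1) block] by simp
  also have "y = \<beta> ^ n - 1 - x"
    using sum unfolding x_def y_def by linarith
  also have "x * \<beta> ^ n + (\<beta> ^ n - 1 - x) = (\<beta> ^ n - 1) * (x + 1)"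
    by (simp add: algebra_simps)
  also have "\<beta> ^ (2 * n) - 1 = (\<beta> ^ n - 1) * (\<beta> ^ n + 1)"
    unfolding mult_2 power_add by (simp add: algebra_simps)
  finally have "(\<beta> ^ n - 1) * ((\<beta> ^ n + 1) * (real p / real q)) = (\<beta> ^ n - 1) * (x + 1)"
    by (simp only: mult.assoc)
  \<comment> \<open>This makes the common factor \<beta>^n - 1 nonzero, so it can be
    cancelled.\<close>
  moreover have "\<beta> ^ n > 1" using assms(1) n by simp
  ultimately have "(\<beta> ^ n + 1) * (real p / real q) = x + 1"
    by (metis mult_left_cancel order_less_irrefl right_minus_eq)
  then have "real p * (\<beta> ^ n + 1) = real q * (x + 1)"
    using pq by (simp add: field_simps)
  then show thesis using that pq n unfolding x_def by blast
qed

section \<open>The power basis and the companion matrix\<close>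

lemma min_poly_root:
  assumes "is_min_poly (map_poly of_int f) \<beta>"
  shows "\<beta> ^ degree f = (\<Sum>i<degree f. of_int (- coeff f i) * \<beta> ^ i)"
proof -
  have deg: "degree (map_poly rat_of_int f) = degree f"
    by (rule degree_map_poly) simp
  have "map_poly of_rat (map_poly rat_of_int f) = (map_poly of_int f :: real poly)"
    by (rule poly_eqI) (simp add: coeff_map_poly)
  then have "poly (map_poly of_int f) \<beta> = 0" and lead: "coeff f (degree f) = 1"
    using assms by (simp_all add: is_min_poly_def deg coeff_map_poly)
  then have "(\<Sum>i\<le>degree f. of_int (coeff f i) * \<beta> ^ i) = 0"
    by (simp add: poly_altdef coeff_map_poly degree_map_poly)
  then show ?thesis
    by (simp add: lessThan_Suc_atMost[symmetric] lead sum_negf)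
qed

text \<open>A nontrivial relation would be a nonzero rational polynomial of degree below
  \<open>degree f\<close> vanishing at \<beta>, against minimality.\<close>

lemma min_poly_lin_indep:
  fixes a :: "nat \<Rightarrow> int"
  assumes "is_min_poly (map_poly of_int f) \<beta>"
    and zero: "(\<Sum>i<degree f. of_int (a i) * \<beta> ^ i) = 0" and "i < degree f"
  shows "a i = 0"
proof -
  define h where "h = (\<Sum>i<degree f. monom (rat_of_int (a i)) i)"
  have coeff: "coeff h k = (if k < degree f then of_int (a k) else 0)" for k
    by (simp add: h_def coeff_sum)
  have "map_poly of_rat h = (\<Sum>i<degree f. monom (of_int (a i) :: real) i)"
    by (rule poly_eqI) (simp add: coeff_map_poly coeff coeff_sum)
  then have root: "poly (map_poly of_rat h) \<beta> = 0"
    using zero by (simp add: poly_sum poly_monom)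
  have "h = 0"
  proof (rule ccontr)
    assume "h \<noteq> 0"
    then have "degree f \<le> degree h"
      using assms(1) root by (simp add: is_min_poly_def degree_map_poly)
    then have "lead_coeff h = 0" by (simp add: coeff)
    with \<open>h \<noteq> 0\<close> show False by simp
  qed
  then show ?thesis using coeff[of i] assms(3) by simp
qed

lemma companion_mat_carrier: "companion_mat f \<in> carrier_mat (degree f) (degree f)"
  by (simp add: companion_mat_def Let_def)

text \<open>The row vector (1, \<beta>, ..., \<beta>^(d-1)), with d the degree of \<open>f\<close>,
  is a left eigenvector for the eigenvalue \<beta>. The subdiagonal ones shift the exponent; the
  last column encodes the equation of \<beta>.\<close>

lemma companion_mat_eigenvector:
  assumes "is_min_poly (map_poly of_int f) \<beta>" "j < degree f"
  shows "(\<Sum>i<degree f. \<beta> ^ i * of_int (companion_mat f $$ (i, j))) = \<beta> ^ Suc j"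
proof (cases "j = degree f - 1")
  case True
  then have "(\<Sum>i<degree f. \<beta> ^ i * of_int (companion_mat f $$ (i, j)))
      = (\<Sum>i<degree f. of_int (- coeff f i) * \<beta> ^ i)"
    using assms(2) by (intro sum.cong) (auto simp: companion_mat_def Let_def)
  also have "\<dots> = \<beta> ^ Suc j"
    using min_poly_root[OF assms(1)] True assms(2) by simp
  finally show ?thesis .
next
  case False
  then have "(\<Sum>i<degree f. \<beta> ^ i * of_int (companion_mat f $$ (i, j)))
      = (\<Sum>i<degree f. if i = Suc j then \<beta> ^ i else 0)"
    using assms(2) by (intro sum.cong) (auto simp: companion_mat_def Let_def)
  then show ?thesis using False assms(2) by (auto simp del: power_Suc)
qed

text \<open>In other terms, column j of the N-th power holds the coordinates of \<beta>^(N+j) in the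
  power basis.\<close>

lemma companion_mat_pow_eigenvector:
  assumes "is_min_poly (map_poly of_int f) \<beta>" "j < degree f"
  shows "(\<Sum>i<degree f. \<beta> ^ i * of_int ((companion_mat f ^\<^sub>m N) $$ (i, j))) = \<beta> ^ (N + j)"
  using assms(2)
proof (induction N arbitrary: j)
  case 0
  then have "(\<Sum>i<degree f. \<beta> ^ i * of_int ((companion_mat f ^\<^sub>m 0) $$ (i, j)))
      = (\<Sum>i<degree f. if i = j then \<beta> ^ i else 0)"
    by (intro sum.cong) (auto simp: carrier_matD[OF companion_mat_carrier])
  then show ?case using 0 by simp
next
  case (Suc N)
  let ?d = "degree f" and ?C = "companion_mat f"
  let ?P = "?C ^\<^sub>m N"
  have P: "?P \<in> carrier_mat ?d ?d"
    by (rule pow_carrier_mat[OF companion_mat_carrier])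
  have entry: "(?P * ?C) $$ (i, j) = (\<Sum>k<?d. ?P $$ (i, k) * ?C $$ (k, j))" if "i < ?d" for i
    using that Suc.prems P companion_mat_carrier[of f]
    by (auto simp: scalar_prod_def lessThan_atLeast0 intro!: sum.cong)
  have "(\<Sum>i<?d. \<beta> ^ i * of_int ((?C ^\<^sub>m Suc N) $$ (i, j)))
      = (\<Sum>i<?d. \<Sum>k<?d. \<beta> ^ i * of_int (?P $$ (i, k)) * of_int (?C $$ (k, j)))"
    by (simp add: entry sum_distrib_left mult.assoc)
  \<comment> \<open>Associativity v (P C) = (v P) C for the row vector v of powers; the induction
    hypothesis is then used at every column k, which is why j is generalised.\<close>
  also have "\<dots> = (\<Sum>k<?d. (\<Sum>i<?d. \<beta> ^ i * of_int (?P $$ (i, k))) * of_int (?C $$ (k, j)))"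
    by (subst sum.swap) (simp add: sum_distrib_right)
  also have "\<dots> = (\<Sum>k<?d. \<beta> ^ (N + k) * of_int (?C $$ (k, j)))"
    by (intro sum.cong) (auto simp: Suc.IH)
  also have "\<dots> = \<beta> ^ N * (\<Sum>k<?d. \<beta> ^ k * of_int (?C $$ (k, j)))"
    by (simp add: sum_distrib_left power_add mult.assoc)
  also have "\<dots> = \<beta> ^ (Suc N + j)"
    using companion_mat_eigenvector[OF assms(1) Suc.prems] by (simp add: power_add)
  finally show ?case .
qed

text \<open>For d the degree of an algebraic integer \<beta> this is the ring \<int>[\<beta>]; only
  the values of \<open>a\<close> below d matter.\<close>

definition power_int_span :: "nat \<Rightarrow> real \<Rightarrow> real set" where
  "power_int_span d \<beta> = range (\<lambda>a :: nat \<Rightarrow> int. \<Sum>i<d. of_int (a i) * \<beta> ^ i)"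

lemma power_int_span_add:
  assumes "z \<in> power_int_span d \<beta>" "w \<in> power_int_span d \<beta>"
  shows "z + w \<in> power_int_span d \<beta>"
proof -
  obtain a b :: "nat \<Rightarrow> int" where "z = (\<Sum>i<d. of_int (a i) * \<beta> ^ i)" "w = (\<Sum>i<d. of_int (b i) * \<beta> ^ i)"
    using assms unfolding power_int_span_def by blast
  then have "z + w = (\<Sum>i<d. of_int (a i + b i) * \<beta> ^ i)"
    by (simp add: sum.distrib distrib_right)
  then show ?thesis unfolding power_int_span_def by (rule range_eqI[where x = "\<lambda>i. a i + b i"])
qed

lemma power_int_span_scale:
  assumes "z \<in> power_int_span d \<beta>"
  shows "of_int k * z \<in> power_int_span d \<beta>"
proof -
  obtain a :: "nat \<Rightarrow> int" where "z = (\<Sum>i<d. of_int (a i) * \<beta> ^ i)"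
    using assms unfolding power_int_span_def by blast
  then have "of_int k * z = (\<Sum>i<d. of_int (k * a i) * \<beta> ^ i)"
    by (simp add: sum_distrib_left mult.assoc)
  then show ?thesis unfolding power_int_span_def by (rule range_eqI[where x = "\<lambda>i. k * a i"])
qed

lemma power_int_span_sum:
  assumes "\<And>i. i \<in> A \<Longrightarrow> g i \<in> power_int_span d \<beta>"
  shows "sum g A \<in> power_int_span d \<beta>"
proof -
  \<comment> \<open>Zero is the value of the empty sum and, by convention, of a sum over an infinite
    \<open>A\<close>.\<close>
  have "0 \<in> power_int_span d \<beta>"
    unfolding power_int_span_def by (rule range_eqI[where x = "\<lambda>_. 0"]) simp
  then show ?thesis using assms
    by (induction A rule: infinite_finite_induct) (auto intro: power_int_span_add)
qed

text \<open>Column 0 of the k-th matrix power supplies the integer coordinates of \<beta>^k.\<close>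

lemma power_in_power_int_span:
  assumes "is_min_poly (map_poly of_int f) \<beta>" "degree f > 0"
  shows "\<beta> ^ k \<in> power_int_span (degree f) \<beta>"
  unfolding power_int_span_def
  using companion_mat_pow_eigenvector[OF assms, of k]
  by (intro range_eqI[where x = "\<lambda>i. (companion_mat f ^\<^sub>m k) $$ (i, 0)"]) (simp add: mult.commute)

text \<open>The number (\<beta>^N + 1) \<beta>^j has two coordinate vectors: column j of C^N + I,
  and m times the integer coordinates of z \<beta>^j. Linear independence identifies them.\<close>

lemma companion_mat_pow_cong_uminus_one:
  assumes min: "is_min_poly (map_poly of_int f) \<beta>" and ij: "i < degree f" "j < degree f"
    and span: "z * \<beta> ^ j \<in> power_int_span (degree f) \<beta>"
    and z: "\<beta> ^ N + 1 = of_int m * z"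
  shows "[(companion_mat f ^\<^sub>m N) $$ (i, j) = (- 1\<^sub>m (degree f)) $$ (i, j)] (mod m)"
proof -
  let ?d = "degree f" and ?P = "companion_mat f ^\<^sub>m N"
  obtain a :: "nat \<Rightarrow> int" where a: "z * \<beta> ^ j = (\<Sum>i<?d. of_int (a i) * \<beta> ^ i)"
    using span unfolding power_int_span_def by blast
  \<comment> \<open>The difference of these two coordinate vectors; the case k = j accounts for the
    summand \<beta>^j.\<close>
  define e where "e k = ?P $$ (k, j) + (if k = j then 1 else 0) - m * a k" for k
  have "(\<Sum>k<?d. of_int (e k) * \<beta> ^ k)
      = (\<Sum>k<?d. \<beta> ^ k * of_int (?P $$ (k, j))) + (\<Sum>k<?d. if k = j then \<beta> ^ k else 0)
        - of_int m * (\<Sum>k<?d. of_int (a k) * \<beta> ^ k)"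
    unfolding sum_distrib_left sum.distrib[symmetric] sum_subtractf[symmetric]
    by (rule sum.cong) (auto simp: e_def algebra_simps)
  also have "\<dots> = (\<beta> ^ N + 1) * \<beta> ^ j - of_int m * (z * \<beta> ^ j)"
    using ij(2) by (simp add: companion_mat_pow_eigenvector[OF min] a power_add distrib_right)
  also have "\<dots> = 0" by (simp add: z)
  finally have "e i = 0" by (rule min_poly_lin_indep[OF min _ ij(1)])
  then have "?P $$ (i, j) - (- 1\<^sub>m ?d) $$ (i, j) = m * a i"
    using ij by (simp add: e_def)
  then show ?thesis by (simp add: cong_iff_dvd_diff)
qed

theorem theorem3p2:
  fixes \<beta> :: real and f :: "int poly" and d q :: nat and C :: "int mat"
  assumes "\<beta> > 1"
    and "algebraic_int \<beta>"
    and "is_min_poly (map_poly of_int f) \<beta>"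
    and "d = degree f"
    and "C = companion_mat f"
    and "q > 2"
    and "midy_property \<beta> q"
  shows "\<exists>N>0. \<forall>i<d. \<forall>j<d. [(C ^\<^sub>m N) $$ (i, j) = (- 1\<^sub>m d) $$ (i, j)] (mod int q)"
proof -
  obtain p n :: nat and c :: "nat \<Rightarrow> int" where pq: "coprime p q" and n: "n \<ge> 1"
    and eq: "real p * (\<beta> ^ n + 1) = real q * ((\<Sum>i=1..n. of_int (c i) * \<beta> ^ (n - i)) + 1)"
    using midy_property_quotient[OF assms(1,7)] by metis
  define x where "x = (\<Sum>i=1..n. of_int (c i) * \<beta> ^ (n - i))"
  \<comment> \<open>Coprimality enters as a Bezout identity, since in \<int>[\<beta>] one cannot
    argue with prime factors.\<close>
  obtain u v :: int where "u * int p + v * int q = 1"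
    using bezout_int[of "int p" "int q"] pq by auto
  then have uv: "of_int u * real p + of_int v * real q = 1"
    by (metis of_int_1 of_int_add of_int_mult of_int_of_nat_eq)
  \<comment> \<open>The quotient (\<beta>^n + 1) / q, written as an integer combination of powers of
    \<beta>: multiply \<beta>^n + 1 by u p + v q = 1 and replace p (\<beta>^n + 1) by q (x +
    1).\<close>
  define z where "z = of_int u * (x + 1) + of_int v * (\<beta> ^ n + 1)"
  have "\<beta> ^ n + 1 = (of_int u * real p + of_int v * real q) * (\<beta> ^ n + 1)"
    by (simp add: uv)
  also have "\<dots> = of_int u * (real p * (\<beta> ^ n + 1)) + of_int v * real q * (\<beta> ^ n + 1)"
    by (simp only: distrib_right mult.assoc)
  also have "\<dots> = of_int (int q) * z"
    unfolding eq[folded x_def] z_def by (simp add: algebra_simps)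
  finally have z: "\<beta> ^ n + 1 = of_int (int q) * z" .
  \<comment> \<open>Expanding the product leaves only integer multiples of powers of \<beta>, so
    closure under sums and integer scaling suffices.\<close>
  have span: "z * \<beta> ^ j \<in> power_int_span d \<beta>" if "j < d" for j
  proof -
    have pow: "\<beta> ^ k \<in> power_int_span d \<beta>" for k
      using power_in_power_int_span[OF assms(3)] that assms(4) by simp
    have "x * \<beta> ^ j = (\<Sum>i=1..n. of_int (c i) * \<beta> ^ (n - i + j))"
      by (simp only: x_def sum_distrib_right power_add mult.assoc)
    then have "x * \<beta> ^ j \<in> power_int_span d \<beta>"
      by (simp add: power_int_span_sum power_int_span_scale pow)
    moreover have "z * \<beta> ^ j
        = of_int u * (x * \<beta> ^ j + \<beta> ^ j) + of_int v * (\<beta> ^ (n + j) + \<beta> ^ j)"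
      by (simp add: z_def power_add algebra_simps)
    ultimately show ?thesis
      by (simp only: power_int_span_add power_int_span_scale pow)
  qed
  show ?thesis
  \<comment> \<open>The exponent is half the length of the shortest period.\<close>
  proof (intro exI[where x = n] conjI allI impI)
    show "n > 0" using n by simp
    fix i j assume "i < d" "j < d"
    then show "[(C ^\<^sub>m n) $$ (i, j) = (- 1\<^sub>m d) $$ (i, j)] (mod int q)"
      using companion_mat_pow_cong_uminus_one[OF assms(3) _ _ _ z] span assms(4,5) by blast
  qed
qed

end
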